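(* Let $q>2$ be a prime power. Let $GRS_{q-1}(\bm a,\bm v)$ be an $[n,q-1]_{q^2}$ Hermitian self-orthogonal GRS code, where $n\ge\frac{q^2-1}{2}$ if $q$ is odd and $n\ge\frac{q^2}{2}$ if $q$ is even. Then the following hold. (1) For $k=q$ and each $0\le s\le q-2$, there exists an $[n,k]_{q^2}$ GRS code with $s$-dimensional Hermitian hull. (2) For $q+1\le k\le 2q-2$ and each $0\le s\le k-4$, there exists an $[n,k]_{q^2}$ GRS code with $s$-dimensional Hermitian hull.
   Context: For a linear code $\mathcal C\subseteq\mathbb F_{q^2}^n$, $\mathcal C^{\perp_H}=\{\bm x:\sum_i y_ix_i^q=0\ \text{for all }\bm y\in\mathcal C\}$, and the Hermitian hull is $\mathrm{Hull}_H(\mathcal C)=\mathcal C\cap\mathcal C^{\perp_H}$; $\mathcal C$ is Hermitian self-orthogonal if $\mathrm{Hull}_H(\mathcal C)=\mathcal C$. For $\bm a=(a_1,\dots,a_n)\in\mathbb F_{q^2}^n$ with distinct entries and $\bm v\in(\mathbb F_{q^2}^* )^n$, the GRS code is $GRS_k(\bm a,\bm v)=\{(v_1f(a_1),\dots,v_nf(a_n)):f\in\mathbb F_{q^2}[x],\deg f\le k-1\}$, $1\le k\le n$. *)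

theory Defs
  imports
    "HOL-Analysis.Cartesian_Space"
    "HOL-Computational_Algebra.Polynomial"
    "HOL-Number_Theory.Prime_Powers"
begin

text \<open>
  Codes of length \<open>n\<close> over a finite field are subsets of \<open>'a ^ 'n\<close> with \<open>n = CARD('n)\<close>.
  In the Hermitian notions \<open>q\<close> is a parameter; they are meant for \<open>CARD('a) = q\<^sup>2\<close>, where
  \<open>x \<mapsto> x ^ q\<close> is the conjugation of the field over its subfield of order \<open>q\<close>.
\<close>

definition linear_code :: "nat \<Rightarrow> ('a::field ^ 'n) set \<Rightarrow> bool" where
  "linear_code k C \<longleftrightarrow> vec.subspace C \<and> vec.dim C = k"

definition hermitian_dual :: "nat \<Rightarrow> ('a::field ^ 'n) set \<Rightarrow> ('a ^ 'n) set" where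
  "hermitian_dual q C = {x. \<forall>y\<in>C. (\<Sum>i\<in>UNIV. y $ i * (x $ i) ^ q) = 0}"

definition hermitian_hull :: "nat \<Rightarrow> ('a::field ^ 'n) set \<Rightarrow> ('a ^ 'n) set" where
  "hermitian_hull q C = C \<inter> hermitian_dual q C"

definition hermitian_self_orthogonal :: "nat \<Rightarrow> ('a::field ^ 'n) set \<Rightarrow> bool" where
  "hermitian_self_orthogonal q C \<longleftrightarrow> hermitian_hull q C = C"

text \<open>
  Since \<open>degree 0 = 0\<close>, the zero polynomial is included; the truncated subtraction is
  harmless because \<open>GRS_params\<close> requires \<open>1 \<le> k\<close>.
\<close>

definition GRS :: "nat \<Rightarrow> 'a::field ^ 'n \<Rightarrow> 'a ^ 'n \<Rightarrow> ('a ^ 'n) set" where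
  "GRS k a v = {(\<chi> i. v $ i * poly f (a $ i)) | f. degree f \<le> k - 1}"

definition GRS_params :: "nat \<Rightarrow> 'a::field ^ 'n \<Rightarrow> 'a ^ 'n \<Rightarrow> bool" where
  "GRS_params k a v \<longleftrightarrow>
     1 \<le> k \<and> k \<le> CARD('n) \<and> (\<forall>i j. i \<noteq> j \<longrightarrow> a $ i \<noteq> a $ j) \<and> (\<forall>i. v $ i \<noteq> 0)"

definition GRS_code :: "nat \<Rightarrow> ('a::field ^ 'n) set \<Rightarrow> bool" where
  "GRS_code k C \<longleftrightarrow> (\<exists>a v. GRS_params k a v \<and> C = GRS k a v)"

end

theory Submission
  imports Defs
begin

text \<open>
  The Hermitian hull of \<open>GRS\<^sub>k(a, v)\<close> can always be shrunk by exactly one dimension: if it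
  contains a word with nonzero \<open>i\<close>-th entry, rescale \<open>v\<^sub>i\<close> by some \<open>l \<noteq> 0\<close> with
  \<open>l\<^sup>q\<^sup>+\<^sup>1 \<noteq> 1\<close>; the new hull is the old one cut by the hyperplane \<open>x\<^sub>i = 0\<close>. So it suffices to
  bound the hull of \<open>GRS\<^sub>k(a, v)\<close> for the given \<open>a\<close> and \<open>v\<close> from below. Self-orthogonality of
  \<open>GRS\<^sub>q\<^sub>-\<^sub>1(a, v)\<close> says that the power sums \<open>\<Sum>\<^sub>i v\<^sub>i\<^sup>q\<^sup>+\<^sup>1 a\<^sub>i\<^sup>x\<^sup>+\<^sup>q\<^sup>y\<close> vanish for \<open>x, y \<le> q - 2\<close>; since
  \<open>a\<^sub>i ^ q\<^sup>2 = a\<^sub>i\<close>, the same holds for \<open>x, y \<le> 2q - 3\<close> as long as neither exponent is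
  \<open>q - 2\<close> or \<open>q - 1\<close>. Hence the Gram matrix of the monomials is supported on two
  rows and two columns (on one row and one column if \<open>k = q\<close>).
\<close>

section \<open>Frobenius map and norms in finite fields\<close>

lemma finite_field_power_card:
  fixes x :: "'a :: {field,finite}"
  shows "x ^ CARD('a) = x"
proof (cases "x = 0")
  case False
  have "x * (\<Prod>y\<in>UNIV-{0}. x * y) = x * x ^ (CARD('a) - 1) * \<Prod>(UNIV-{0})"
    by (simp add: prod.distrib mult_ac)
  also have "x * x ^ (CARD('a) - 1) = x ^ CARD('a)"
    by (simp flip: power_Suc)
  \<comment> \<open>Multiplication by \<open>x\<close> permutes the nonzero elements, whose product
    then cancels.\<close>
  also have "(\<Prod>y\<in>UNIV-{0}. x * y) = \<Prod>(UNIV-{0})"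
    by (rule prod.reindex_bij_witness[of _ "\<lambda>y. y / x" "\<lambda>y. x * y"]) (use False in auto)
  finally show ?thesis
    by simp
qed simp

text \<open>\<open>q\<close> is a power of the characteristic, so the \<open>q\<close>-th power map
  iterates Frobenius.\<close>

lemma finite_field_frobenius_sum:
  fixes f :: "'b \<Rightarrow> 'a :: {field,finite}"
  assumes "primepow q" and card: "CARD('a) = q ^ 2"
  shows "(\<Sum>i\<in>A. f i) ^ q = (\<Sum>i\<in>A. f i ^ q)"
proof -
  obtain p m where p: "prime p" and q: "q = p ^ m"
    using \<open>primepow q\<close> by (auto simp: primepow_def)
  have char: "prime CHAR('a)"
    by (rule prime_CHAR_semidom) (rule finite_imp_CHAR_pos, simp)
  \<comment> \<open>Shifting the summation variable by 1 forces the field order to vanish in the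
    field.\<close>
  have "(\<Sum>x\<in>UNIV. x + 1 :: 'a) = (\<Sum>x\<in>UNIV. x)"
    by (rule sum.reindex_bij_witness[of _ "\<lambda>x. x - 1" "\<lambda>x. x + 1"]) auto
  then have "of_nat CARD('a) = (0 :: 'a)"
    by (simp add: sum.distrib)
  then have "CHAR('a) dvd p ^ (m * 2)"
    unfolding of_nat_eq_0_iff_char_dvd card q by (simp add: power_mult)
  then have "CHAR('a) = p"
    using char p by (metis prime_dvd_power primes_dvd_imp_eq)
  then show ?thesis
    using freshmans_dream_sum'[OF char] q by blast
qed

text \<open>Norm-one elements are roots of a polynomial of degree \<open>q + 1\<close>; with zero
  they number at most \<open>q + 2\<close>, less than \<open>q * q\<close>.\<close>

lemma exists_norm_neq_one:
  assumes "q > 2" and card: "CARD('a :: {field,finite}) = q ^ 2"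
  shows "\<exists>l::'a. l \<noteq> 0 \<and> l ^ (q + 1) \<noteq> 1"
proof (rule ccontr)
  assume "\<not> ?thesis"
  then have "UNIV \<subseteq> insert 0 {l::'a. l ^ (q + 1) = 1}"
    by auto
  then have "CARD('a) \<le> card (insert 0 {l::'a. l ^ (q + 1) = 1})"
    by (intro card_mono) auto
  also have "\<dots> \<le> Suc (card {l::'a. l ^ (q + 1) = 1})"
    by (rule card_insert_le_m1) auto
  also have "card {l::'a. l ^ (q + 1) = 1} \<le> q + 1"
  proof -
    let ?p = "monom 1 (q + 1) - 1 :: 'a poly"
    have "coeff ?p (q + 1) = 1"
      by simp
    then have "?p \<noteq> 0"
      by (metis coeff_0 zero_neq_one)
    moreover have "degree ?p \<le> q + 1"
      by (intro degree_diff_le) (auto simp: degree_monom_eq)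
    ultimately show ?thesis
      using card_poly_roots_bound[of ?p] by (simp add: poly_monom)
  qed
  finally have "q * q \<le> q + 2"
    by (simp add: card power2_eq_square)
  moreover have "3 * q \<le> q * q"
    using \<open>q > 2\<close> by simp
  ultimately show False
    using \<open>q > 2\<close> by linarith
qed

section \<open>The Hermitian form and the hull\<close>

definition herm :: "nat \<Rightarrow> 'a::field ^ 'n \<Rightarrow> 'a ^ 'n \<Rightarrow> 'a" where
  "herm q x y = (\<Sum>i\<in>UNIV. x $ i * (y $ i) ^ q)"

lemma herm_add_left: "herm q (x + y) z = herm q x z + herm q y z"
  by (simp add: herm_def sum.distrib distrib_right)

lemma herm_scale_left: "herm q (c *s x) z = c * herm q x z"
  by (simp add: herm_def sum_distrib_left mult_ac)

lemma herm_zero_left: "herm q 0 z = 0"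
  by (simp add: herm_def)

lemma subspace_herm_zero: "vec.subspace {x. herm q x y = 0}"
  by (auto intro!: vec.subspaceI simp: herm_add_left herm_scale_left herm_zero_left)

text \<open>Conjugation is additive and, on a field of order \<open>q ^ 2\<close>, an involution; so
  it swaps the two arguments.\<close>

lemma herm_power:
  fixes x y :: "'a::{field,finite} ^ 'n"
  assumes "primepow q" and "CARD('a) = q ^ 2"
  shows "herm q x y ^ q = herm q y x"
proof -
  have "(c ^ q) ^ q = c" for c :: 'a
    using finite_field_power_card[of c] assms(2)
    by (simp add: power2_eq_square flip: power_mult)
  then show ?thesis
    by (simp add: herm_def finite_field_frobenius_sum[OF assms] power_mult_distrib mult.commute)
qed

lemma herm_zero_sym:
  fixes x y :: "'a::{field,finite} ^ 'n"
  assumes "primepow q" and "CARD('a) = q ^ 2"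
  shows "herm q x y = 0 \<longleftrightarrow> herm q y x = 0"
proof -
  have "q > 0" using assms(1) by (rule primepow_gt_0_nat)
  then show ?thesis
    using herm_power[OF assms, of x y] herm_power[OF assms, of y x] by (metis power_0_left neq0_conv)
qed

text \<open>In the dual, \<open>x\<close> stands in the conjugated argument. Symmetry of
  orthogonality moves it to the linear one, so each \<open>y\<close> imposes a linear
  condition.\<close>

lemma hermitian_hull_iff:
  fixes C :: "('a::{field,finite} ^ 'n) set"
  assumes "primepow q" and "CARD('a) = q ^ 2"
  shows "x \<in> hermitian_hull q C \<longleftrightarrow> x \<in> C \<and> (\<forall>y\<in>C. herm q x y = 0)"
  using herm_zero_sym[OF assms]
  by (auto simp: hermitian_hull_def hermitian_dual_def simp flip: herm_def)

lemma subspace_hermitian_hull: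
  fixes C :: "('a::{field,finite} ^ 'n) set"
  assumes "primepow q" and "CARD('a) = q ^ 2" and "vec.subspace C"
  shows "vec.subspace (hermitian_hull q C)"
proof -
  have "hermitian_hull q C = C \<inter> (\<Inter>y\<in>C. {x. herm q x y = 0})"
    using hermitian_hull_iff[OF assms(1,2)] by blast
  also have "vec.subspace \<dots>"
    by (intro vec.subspace_inter assms vec.subspace_Inter) (auto intro: subspace_herm_zero)
  finally show ?thesis .
qed

text \<open>If \<open>f x \<noteq> 0\<close>, subtracting a multiple of \<open>x\<close> sends any
  vector of \<open>V\<close> into the kernel, so \<open>x\<close> and the kernel span
  \<open>V\<close>.\<close>

lemma dim_Int_hyperplane:
  fixes V :: "('a::field ^ 'n) set" and f :: "'a ^ 'n \<Rightarrow> 'a"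
  assumes V: "vec.subspace V"
    and add: "\<And>x y. f (x + y) = f x + f y" and scale: "\<And>c x. f (c *s x) = c * f x"
  shows "vec.dim V \<le> vec.dim {x\<in>V. f x = 0} + 1"
proof (cases "\<exists>x\<in>V. f x \<noteq> 0")
  case False
  then have "{x\<in>V. f x = 0} = V" by auto
  then show ?thesis by simp
next
  case True
  then obtain x where x: "x \<in> V" "f x \<noteq> 0" by blast
  have "V \<subseteq> vec.span (insert x {x\<in>V. f x = 0})"
  proof
    fix y assume y: "y \<in> V"
    let ?c = "- f y / f x"
    have "f (y + ?c *s x) = 0"
      using x(2) by (simp only: add scale) (simp add: field_simps)
    moreover have "y + ?c *s x \<in> V"
      by (intro vec.subspace_add vec.subspace_scale V x y)
    ultimately have "y - (- ?c) *s x \<in> vec.span {x\<in>V. f x = 0}"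
      by (intro vec.span_base) simp
    then show "y \<in> vec.span (insert x {x\<in>V. f x = 0})"
      by (auto simp: vec.span_insert)
  qed
  from vec.dim_mono[OF this] show ?thesis
    by (simp add: vec.dim_insert split: if_splits)
qed

section \<open>The monomial basis of a GRS code\<close>

definition GRS_monom :: "'a::field ^ 'n \<Rightarrow> 'a ^ 'n \<Rightarrow> nat \<Rightarrow> 'a ^ 'n" where
  "GRS_monom a v j = (\<chi> i. v $ i * (a $ i) ^ j)"

lemma GRS_eq_span:
  assumes "1 \<le> k"
  shows "GRS k a v = vec.span (GRS_monom a v ` {..<k})"
proof (intro equalityI subsetI)
  fix x assume "x \<in> GRS k a v"
  then obtain f where f: "degree f \<le> k - 1" "x = (\<chi> i. v $ i * poly f (a $ i))"
    by (auto simp: GRS_def)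
  have poly_f: "poly f c = (\<Sum>j<k. coeff f j * c ^ j)" for c
    unfolding poly_altdef using f(1) assms
    by (intro sum.mono_neutral_left) (auto simp: coeff_eq_0)
  have "x = (\<Sum>j<k. coeff f j *s GRS_monom a v j)"
    unfolding f(2) by (simp add: vec_eq_iff poly_f GRS_monom_def sum_distrib_left mult_ac)
  then show "x \<in> vec.span (GRS_monom a v ` {..<k})"
    by (simp only:) (intro vec.span_sum vec.span_scale vec.span_base imageI)
next
  have sub: "vec.subspace (GRS k a v)"
  proof (rule vec.subspaceI)
    show "0 \<in> GRS k a v"
      by (auto simp: GRS_def vec_eq_iff intro!: exI[of _ 0])
    fix x y assume "x \<in> GRS k a v" "y \<in> GRS k a v"
    then obtain f g where "degree f \<le> k - 1" "x = (\<chi> i. v $ i * poly f (a $ i))"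
      "degree g \<le> k - 1" "y = (\<chi> i. v $ i * poly g (a $ i))"
      by (auto simp: GRS_def)
    then show "x + y \<in> GRS k a v"
      by (auto simp: GRS_def vec_eq_iff distrib_left degree_add_le intro!: exI[of _ "f + g"])
  next
    fix c x assume "x \<in> GRS k a v"
    then obtain f where f: "degree f \<le> k - 1" "x = (\<chi> i. v $ i * poly f (a $ i))"
      by (auto simp: GRS_def)
    then have "degree (smult c f) \<le> k - 1"
      using degree_smult_le order_trans by blast
    then show "c *s x \<in> GRS k a v"
      using f(2) by (auto simp: GRS_def vec_eq_iff mult_ac intro!: exI[of _ "smult c f"])
  qed
  have "GRS_monom a v j \<in> GRS k a v" if "j < k" for j
    using that by (auto simp: GRS_def GRS_monom_def vec_eq_iff degree_monom_eq poly_monom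
        intro!: exI[of _ "monom 1 j"])
  then have "vec.span (GRS_monom a v ` {..<k}) \<subseteq> GRS k a v"
    by (intro vec.span_minimal sub) auto
  then show "x \<in> GRS k a v" if "x \<in> vec.span (GRS_monom a v ` {..<k})" for x
    using that by blast
qed

text \<open>A nontrivial relation would be a nonzero polynomial of degree at most
  \<open>k - 1\<close> vanishing at all entries of \<open>a\<close>, which are distinct and at least
  \<open>k\<close> in number.\<close>

lemma GRS_monom_combination_zero:
  fixes a v :: "'a::field ^ 'n"
  assumes "GRS_params k a v"
    and zero: "(\<Sum>j<k. c j *s GRS_monom a v j) = 0" and "j < k"
  shows "c j = 0"
proof (rule ccontr)
  assume nz: "c j \<noteq> 0"
  define p where "p = (\<Sum>j<k. monom (c j) j)"
  have coeff: "coeff p m = (if m < k then c m else 0)" for m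
    by (simp add: p_def coeff_sum)
  then have "p \<noteq> 0" and "degree p \<le> k - 1"
    using nz \<open>j < k\<close> by (auto intro!: degree_le simp: poly_eq_iff)
  have "range (($) a) \<subseteq> {x. poly p x = 0}"
  proof clarsimp
    fix i
    have "(\<Sum>j<k. c j *s GRS_monom a v j) $ i = 0"
      by (simp add: zero)
    then have "v $ i * poly p (a $ i) = 0"
      by (simp add: p_def poly_sum poly_monom GRS_monom_def sum_distrib_left mult_ac)
    then show "poly p (a $ i) = 0"
      using assms(1) by (simp add: GRS_params_def)
  qed
  then have "card (range (($) a)) \<le> card {x. poly p x = 0}"
    by (intro card_mono poly_roots_finite \<open>p \<noteq> 0\<close>)
  also have "\<dots> \<le> k - 1"
    using card_poly_roots_bound[OF \<open>p \<noteq> 0\<close>] \<open>degree p \<le> k - 1\<close> by linarith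
  also have "card (range (($) a)) = CARD('n)"
    using assms(1) by (intro card_image injI) (metis GRS_params_def)
  finally show False
    using assms(1) by (auto simp: GRS_params_def)
qed

lemma dim_span_GRS_monom:
  fixes a v :: "'a::field ^ 'n"
  assumes "GRS_params k a v" and "J \<subseteq> {..<k}"
  shows "vec.dim (vec.span (GRS_monom a v ` J)) = card J"
proof -
  \<comment> \<open>Independence concerns a set of vectors; injectivity translates sums over it into
    sums over exponents.\<close>
  have inj: "inj_on (GRS_monom a v) {..<k}"
  proof (rule inj_onI, rule ccontr)
    fix i j assume ij: "i \<in> {..<k}" "j \<in> {..<k}" "i \<noteq> j" and eq: "GRS_monom a v i = GRS_monom a v j"
    let ?c = "\<lambda>m. (if m = i then 1 else 0) - (if m = j then 1 else 0) :: 'a"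
    have "(\<Sum>m<k. ?c m *s GRS_monom a v m) = 0"
      using ij eq by (simp add: vec.scale_left_diff_distrib sum_subtractf if_distrib[of "\<lambda>c. c *s _"] cong: if_cong)
    from GRS_monom_combination_zero[OF assms(1) this, of i] show False
      using ij by simp
  qed
  have "vec.independent (GRS_monom a v ` {..<k})"
  proof (rule vec.independent_if_scalars_zero)
    fix f x assume "(\<Sum>x\<in>GRS_monom a v ` {..<k}. f x *s x) = 0" "x \<in> GRS_monom a v ` {..<k}"
    then show "f x = 0"
      using GRS_monom_combination_zero[OF assms(1), of "f \<circ> GRS_monom a v"]
      by (auto simp: sum.reindex[OF inj])
  qed simp
  then have "vec.independent (GRS_monom a v ` J)"
    using assms(2) by (rule vec.independent_mono[OF _ image_mono])
  then have "vec.dim (vec.span (GRS_monom a v ` J)) = card (GRS_monom a v ` J)"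
    by (rule vec.dim_span_eq_card_independent)
  then show ?thesis
    using card_image[OF inj_on_subset[OF inj assms(2)]] by simp
qed

lemma linear_code_GRS:
  assumes "GRS_params k a v"
  shows "linear_code k (GRS k a v)"
proof -
  have "GRS k a v = vec.span (GRS_monom a v ` {..<k})"
    using assms by (intro GRS_eq_span) (simp add: GRS_params_def)
  then show ?thesis
    using dim_span_GRS_monom[OF assms, of "{..<k}"] by (simp add: linear_code_def)
qed

section \<open>Lowering the hull dimension one step at a time\<close>

lemma GRS_hull_pred:
  fixes a v :: "'a::{field,finite} ^ 'n"
  assumes q: "primepow q" "CARD('a) = q ^ 2" and "q > 2"
    and params: "GRS_params k a v" and dim: "vec.dim (hermitian_hull q (GRS k a v)) = Suc s"
  shows "\<exists>w. GRS_params k a w \<and> vec.dim (hermitian_hull q (GRS k a w)) = s"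
proof -
  define C H where "C = GRS k a v" and "H = hermitian_hull q C"
  have sub: "vec.subspace H"
    using linear_code_GRS[OF params] subspace_hermitian_hull[OF q] by (auto simp: H_def C_def linear_code_def)
  have "\<not> H \<subseteq> {0}"
    using dim vec.dim_subset[of H "{0}"] by (auto simp: H_def C_def)
  then obtain x where x: "x \<in> H" "x \<noteq> 0" by blast
  then obtain i where i: "x $ i \<noteq> 0" by (auto simp: vec_eq_iff)
  obtain l :: 'a where l: "l \<noteq> 0" "l ^ (q + 1) \<noteq> 1"
    using exists_norm_neq_one[OF \<open>q > 2\<close> q(2)] by blast
  define D where "D y = (\<chi> j. if j = i then l * y $ i else y $ j)" for y :: "'a ^ 'n"
  have GRS_D: "GRS k a (D v) = D ` C"
  proof -
    have "(\<chi> j. D v $ j * poly f (a $ j)) = D (\<chi> j. v $ j * poly f (a $ j))" for f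
      by (simp add: D_def vec_eq_iff)
    then show ?thesis
      by (auto simp: GRS_def C_def)
  qed
  \<comment> \<open>Only the \<open>i\<close>-th term changes, which perturbs the form by one of
    rank one.\<close>
  have herm_D: "herm q (D y) (D z) = herm q y z + (l ^ (q + 1) - 1) * (y $ i * (z $ i) ^ q)" for y z
  proof -
    have "herm q (D y) (D z) = l ^ (q + 1) * (y $ i * (z $ i) ^ q) + (\<Sum>j\<in>UNIV - {i}. y $ j * (z $ j) ^ q)"
      unfolding herm_def by (subst sum.remove[of _ i]) (auto simp: D_def power_mult_distrib mult_ac intro!: sum.cong)
    moreover have "herm q y z = y $ i * (z $ i) ^ q + (\<Sum>j\<in>UNIV - {i}. y $ j * (z $ j) ^ q)"
      unfolding herm_def by (subst sum.remove[of _ i]) auto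
    ultimately show ?thesis
      by (simp add: algebra_simps)
  qed
  have D_fix: "D y = y" if "y $ i = 0" for y
    using that by (simp add: D_def vec_eq_iff)
  have hull: "hermitian_hull q (D ` C) = {y\<in>H. y $ i = 0}"
  proof (intro equalityI subsetI)
    fix y' assume "y' \<in> hermitian_hull q (D ` C)"
    then obtain y where y: "y' = D y" "y \<in> C" and *: "\<And>z. z \<in> C \<Longrightarrow> herm q (D y) (D z) = 0"
      by (auto simp: hermitian_hull_iff[OF q])
    \<comment> \<open>Testing against \<open>x\<close> from the old hull removes the unperturbed
      form and leaves a nonzero multiple of \<open>y $ i\<close>.\<close>
    have "x \<in> C" and "herm q y x = 0"
      using x(1) y(2) by (auto simp: H_def hermitian_hull_iff[OF q] herm_zero_sym[OF q, of y x])
    then have "y $ i = 0"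
      using *[of x] i l by (simp add: herm_D)
    then show "y' \<in> {y\<in>H. y $ i = 0}"
      using y *[unfolded herm_D] by (simp add: D_fix H_def hermitian_hull_iff[OF q])
  next
    fix y assume y: "y \<in> {y\<in>H. y $ i = 0}"
    then have "y = D y" "y \<in> C"
      by (auto simp: D_fix H_def hermitian_hull_def)
    moreover have "herm q (D y) (D z) = 0" if "z \<in> C" for z
      unfolding herm_D using y that by (simp add: H_def hermitian_hull_iff[OF q])
    ultimately show "y \<in> hermitian_hull q (D ` C)"
      by (auto simp: hermitian_hull_iff[OF q])
  qed
  let ?K = "{y\<in>H. y $ i = 0}"
  have "vec.subspace ?K"
    using sub by (auto simp: vec.subspace_def)
  \<comment> \<open>\<open>x\<close> lies in \<open>H\<close> but not in \<open>?K\<close>, so the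
    dimension drops; a single hyperplane lowers it by at most one.\<close>
  then have "vec.dim ?K < vec.dim H"
    using x i sub by (intro vec.dim_psubset) (auto simp: vec.span_eq_iff[THEN iffD2])
  moreover have "vec.dim H \<le> vec.dim ?K + 1"
    by (rule dim_Int_hyperplane[OF sub]) auto
  ultimately have "vec.dim ?K = s"
    using dim by (simp add: H_def C_def)
  moreover have "GRS_params k a (D v)"
    using params l by (auto simp: GRS_params_def D_def)
  ultimately show ?thesis
    using GRS_D hull by metis
qed

lemma GRS_hull_decrease:
  fixes a v :: "'a::{field,finite} ^ 'n"
  assumes "primepow q" "CARD('a) = q ^ 2" "q > 2"
    and "GRS_params k a v" and "s \<le> vec.dim (hermitian_hull q (GRS k a v))"
  shows "\<exists>w. GRS_params k a w \<and> vec.dim (hermitian_hull q (GRS k a w)) = s"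
  using assms(5)
proof (induction s rule: inc_induct)
  case base
  then show ?case using assms(4) by blast
next
  case (step s)
  then show ?case using GRS_hull_pred[OF assms(1-3)] by blast
qed

lemma GRS_hull_codes:
  fixes a v :: "'a::{field,finite} ^ 'n"
  assumes "primepow q" "CARD('a) = q ^ 2" "q > 2"
    and "GRS_params k a v" and "s \<le> vec.dim (hermitian_hull q (GRS k a v))"
  shows "\<exists>C :: ('a ^ 'n) set. linear_code k C \<and> GRS_code k C \<and> vec.dim (hermitian_hull q C) = s"
  using GRS_hull_decrease[OF assms] linear_code_GRS unfolding GRS_code_def by blast

section \<open>Lower bound for the hull from the Gram matrix of the monomials\<close>

text \<open>Combinations of the monomials in \<open>J\<close> are orthogonal to every monomial
  outside \<open>B\<close>; each element of \<open>B\<close> adds one linear condition and costs at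
  most one dimension.\<close>

lemma dim_GRS_hull_ge:
  fixes a v :: "'a::{field,finite} ^ 'n"
  assumes q: "primepow q" "CARD('a) = q ^ 2" and params: "GRS_params k a v"
    and "finite B" "J \<subseteq> {..<k}"
    and zero: "\<And>x y. x \<in> J \<Longrightarrow> y < k \<Longrightarrow> y \<notin> B \<Longrightarrow> herm q (GRS_monom a v x) (GRS_monom a v y) = 0"
  shows "card J \<le> vec.dim (hermitian_hull q (GRS k a v)) + card B"
proof -
  let ?m = "GRS_monom a v"
  define V where "V B = vec.span (?m ` J) \<inter> (\<Inter>y\<in>B. {x. herm q x (?m y) = 0})" for B
  have subV: "vec.subspace (V B)" for B
    unfolding V_def by (intro vec.subspace_inter vec.subspace_Inter) (auto intro: subspace_herm_zero)
  have "card J \<le> vec.dim (V B) + card B"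
    using \<open>finite B\<close>
  proof (induction B rule: finite_induct)
    case empty
    then show ?case
      using dim_span_GRS_monom[OF params \<open>J \<subseteq> {..<k}\<close>] by (simp add: V_def)
  next
    case (insert b B)
    have "V (insert b B) = {x \<in> V B. herm q x (?m b) = 0}"
      by (auto simp: V_def)
    then have "vec.dim (V B) \<le> vec.dim (V (insert b B)) + 1"
      using dim_Int_hyperplane[OF subV, of "\<lambda>x. herm q x (?m b)" B]
      by (simp add: herm_add_left herm_scale_left)
    then show ?case
      using insert by simp
  qed
  moreover have "V B \<subseteq> hermitian_hull q (GRS k a v)"
  proof
    fix x assume x: "x \<in> V B"
    have C: "GRS k a v = vec.span (?m ` {..<k})"
      using params by (intro GRS_eq_span) (simp add: GRS_params_def)
    have "x \<in> GRS k a v"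
      using x \<open>J \<subseteq> {..<k}\<close> vec.span_mono[of "?m ` J" "?m ` {..<k}"] by (auto simp: V_def C)
    moreover have "herm q x (?m y) = 0" if "y < k" for y
    proof (cases "y \<in> B")
      case False
      then have "vec.span (?m ` J) \<subseteq> {x. herm q x (?m y) = 0}"
        using zero that by (intro vec.span_minimal subspace_herm_zero) auto
      then show ?thesis
        using x by (auto simp: V_def)
    qed (use x in \<open>auto simp: V_def\<close>)
    \<comment> \<open>With \<open>x\<close> as second argument the condition is linear in
      \<open>y\<close>, so it passes from the monomials to their span.\<close>
    then have "vec.span (?m ` {..<k}) \<subseteq> {y. herm q y x = 0}"
      by (intro vec.span_minimal subspace_herm_zero) (auto simp: herm_zero_sym[OF q, of _ x])
    then have "\<forall>y\<in>GRS k a v. herm q x y = 0"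
      by (auto simp: C herm_zero_sym[OF q, of x])
    ultimately show "x \<in> hermitian_hull q (GRS k a v)"
      by (simp add: hermitian_hull_iff[OF q])
  qed
  then have "vec.dim (V B) \<le> vec.dim (hermitian_hull q (GRS k a v))"
    by (rule vec.dim_subset)
  ultimately show ?thesis by linarith
qed

text \<open>The Gram entry depends on the exponents only through \<open>x + q * y\<close>, so one
  pair of exponents can be traded for another.\<close>

lemma herm_GRS_monom:
  "herm q (GRS_monom a v x) (GRS_monom a v y) = (\<Sum>i\<in>UNIV. v $ i ^ (q + 1) * a $ i ^ (x + q * y))"
  by (simp add: herm_def GRS_monom_def power_mult_distrib power_add power_mult mult_ac flip: power_mult)

text \<open>Exponents reduce modulo \<open>q ^ 2 - 1\<close>; the remaining \<open>m + 1\<close> is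
  positive, so the rule also holds at \<open>c = 0\<close>.\<close>

lemma power_mod_field:
  fixes c :: "'a :: {field,finite}"
  assumes "CARD('a) = q ^ 2"
  shows "c ^ (q * q + m) = c ^ (m + 1)"
  using finite_field_power_card[of c] assms by (simp add: power_add power2_eq_square mult.commute)

text \<open>
  With \<open>x = q + x'\<close>, the exponent \<open>x + q * y\<close> equals \<open>x' + q * (y + 1)\<close>; with \<open>y = q + y'\<close> it is
  congruent to \<open>(x + 1) + q * y'\<close> modulo \<open>q\<^sup>2 - 1\<close>.
\<close>
lemma herm_GRS_monom_zero:
  fixes a v :: "'a::{field,finite} ^ 'n"
  assumes card: "CARD('a) = q ^ 2" and "q > 2"
    and zero: "\<And>x y. x \<le> q - 2 \<Longrightarrow> y \<le> q - 2 \<Longrightarrow> herm q (GRS_monom a v x) (GRS_monom a v y) = 0"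
    and x: "x < 2 * q - 2" "x \<notin> {q - 2, q - 1}" and y: "y < 2 * q - 2" "y \<notin> {q - 2, q - 1}"
  shows "herm q (GRS_monom a v x) (GRS_monom a v y) = 0"
proof -
  \<comment> \<open>With \<open>q - 2\<close> and \<open>q - 1\<close> excluded, an exponent below
    \<open>q\<close> is at most \<open>q - 3\<close> and stays in the range of \<open>zero\<close>
    when raised by 1.\<close>
  consider "x \<le> q - 2" "y \<le> q - 2" | "x \<ge> q" "y + 1 \<le> q - 2" | "x + 1 \<le> q - 2" "y \<ge> q" | "x \<ge> q" "y \<ge> q"
    using x y \<open>q > 2\<close> by fastforce
  then show ?thesis
  proof cases
    case 1
    then show ?thesis by (rule zero)
  next
    case 2
    then have "x + q * y = (x - q) + q * (y + 1)" by simp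
    then have "herm q (GRS_monom a v x) (GRS_monom a v y)
        = herm q (GRS_monom a v (x - q)) (GRS_monom a v (y + 1))"
      unfolding herm_GRS_monom by simp
    also have "\<dots> = 0"
      using 2 x by (intro zero) auto
    finally show ?thesis .
  next
    case 3
    obtain y' where y': "y = q + y'"
      using 3 le_Suc_ex by blast
    have e: "x + q * y = q * q + (x + q * y')"
      by (simp add: y' algebra_simps)
    have "herm q (GRS_monom a v x) (GRS_monom a v y)
        = herm q (GRS_monom a v (x + 1)) (GRS_monom a v y')"
      unfolding herm_GRS_monom e power_mod_field[OF card] by (simp add: add_ac)
    also have "\<dots> = 0"
      using 3 y y' by (intro zero) auto
    finally show ?thesis .
  next
    case 4
    obtain x' y' where xy': "x = q + x'" "y = q + y'"
      using 4 le_Suc_ex by metis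
    \<comment> \<open>Both shifts act at once. The bound \<open>2 * q - 2\<close> keeps
      \<open>x'\<close> and \<open>y'\<close> at most \<open>q - 3\<close>, with room for both
      increments.\<close>
    have e: "x + q * y = q * q + (x' + q * (y' + 1))"
      by (simp add: xy' algebra_simps)
    have "herm q (GRS_monom a v x) (GRS_monom a v y)
        = herm q (GRS_monom a v (x' + 1)) (GRS_monom a v (y' + 1))"
      unfolding herm_GRS_monom e power_mod_field[OF card] by (simp add: add_ac)
    also have "\<dots> = 0"
      using x y xy' by (intro zero) auto
    finally show ?thesis .
  qed
qed

theorem corollary6:
  fixes q :: nat and a v :: "'a::{field,finite} ^ 'n"
  assumes "primepow q" and "q > 2"
    and "CARD('a) = q ^ 2"
    and "GRS_params (q - 1) a v"
    and "linear_code (q - 1) (GRS (q - 1) a v)"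
    and "hermitian_self_orthogonal q (GRS (q - 1) a v)"
    and "odd q \<Longrightarrow> real CARD('n) \<ge> (real q ^ 2 - 1) / 2"
    and "even q \<Longrightarrow> real CARD('n) \<ge> real q ^ 2 / 2"
  shows "(\<forall>s. s \<le> q - 2 \<longrightarrow>
            (\<exists>C :: ('a ^ 'n) set. linear_code q C \<and> GRS_code q C \<and>
               vec.dim (hermitian_hull q C) = s))
       \<and> (\<forall>k s. q + 1 \<le> k \<and> k \<le> 2 * q - 2 \<and> s \<le> k - 4 \<longrightarrow>
            (\<exists>C :: ('a ^ 'n) set. linear_code k C \<and> GRS_code k C \<and>
               vec.dim (hermitian_hull q C) = s))"
proof -
  have q: "primepow q" "CARD('a) = q ^ 2" "q > 2"
    using assms by simp_all
  \<comment> \<open>This makes the length sufficient for every \<open>k\<close> in question. Both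
    parities give \<open>q ^ 2 \<le> 2 * CARD('n) + 1\<close>, and
    \<open>(q - 1) * (q - 3) \<ge> 0\<close> gives \<open>4 * q - 3 \<le> q ^ 2\<close>.\<close>
  have n: "2 * q - 2 \<le> CARD('n)"
  proof -
    have "q ^ 2 \<le> 2 * CARD('n) + 1"
    proof (cases "odd q")
      case True
      with assms(7) have "real (q ^ 2) \<le> real (2 * CARD('n) + 1)" by simp
      then show ?thesis by (simp only: of_nat_le_iff)
    next
      case False
      with assms(8) have "real (q ^ 2) \<le> real (2 * CARD('n))" by simp
      then show ?thesis by (simp only: of_nat_le_iff)
    qed
    moreover have "q * q + 3 \<ge> 4 * q"
    proof -
      obtain r where "q = r + 3"
        using \<open>q > 2\<close> by (metis add.commute le_Suc_ex Suc_leI numeral_3_eq_3 numeral_2_eq_2)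
      then show ?thesis by (simp add: algebra_simps)
    qed
    ultimately show ?thesis
      by (simp add: power2_eq_square)
  qed
  have params: "GRS_params k a v" if "1 \<le> k" "k \<le> 2 * q - 2" for k
    using assms(4) n that by (simp add: GRS_params_def)
  have zero: "herm q (GRS_monom a v x) (GRS_monom a v y) = 0" if "x \<le> q - 2" "y \<le> q - 2" for x y
  proof -
    have "GRS_monom a v j \<in> GRS (q - 1) a v" if "j \<le> q - 2" for j
      using that \<open>q > 2\<close> by (subst GRS_eq_span) (auto intro!: vec.span_base imageI)
    then show ?thesis
      using that assms(6) hermitian_hull_iff[OF q(1,2), of _ "GRS (q - 1) a v"]
      by (auto simp: hermitian_self_orthogonal_def)
  qed
  have "\<exists>C :: ('a ^ 'n) set. linear_code q C \<and> GRS_code q C \<and> vec.dim (hermitian_hull q C) = s"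
    if "s \<le> q - 2" for s
  proof (rule GRS_hull_codes[OF q])
    show par: "GRS_params q a v"
      using \<open>q > 2\<close> by (intro params) auto
    \<comment> \<open>\<open>zero\<close> covers all exponents below \<open>q - 1\<close>, so only
      the condition at \<open>q - 1\<close> remains: \<open>q - 1 - 1\<close>.\<close>
    have "card {..<q - 1} \<le> vec.dim (hermitian_hull q (GRS q a v)) + card {q - 1}"
      by (rule dim_GRS_hull_ge[OF q(1,2) par]) (auto intro!: zero)
    then show "s \<le> vec.dim (hermitian_hull q (GRS q a v))"
      using that by simp
  qed
  moreover have "\<exists>C :: ('a ^ 'n) set. linear_code k C \<and> GRS_code k C \<and> vec.dim (hermitian_hull q C) = s"
    if k: "q + 1 \<le> k" "k \<le> 2 * q - 2" and "s \<le> k - 4" for k s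
  proof (rule GRS_hull_codes[OF q])
    show par: "GRS_params k a v"
      using k by (intro params) auto
    \<comment> \<open>The two exceptional exponents count twice, as omitted generators and as
      remaining conditions: \<open>k - 2 - 2\<close>.\<close>
    let ?B = "{q - 2, q - 1}"
    have B: "card ?B = 2" "card ({..<k} - ?B) = k - 2"
      using \<open>q > 2\<close> k by (auto simp: card_Diff_subset)
    have "card ({..<k} - ?B) \<le> vec.dim (hermitian_hull q (GRS k a v)) + card ?B"
      by (rule dim_GRS_hull_ge[OF q(1,2) par])
        (use k in \<open>auto intro!: herm_GRS_monom_zero[OF q(2,3) zero]\<close>)
    then show "s \<le> vec.dim (hermitian_hull q (GRS k a v))"
      using that B by linarith
  qed
  ultimately show ?thesis by blast
qed

end
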